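(* Let $(X_k)_{k\ge1}$ be a stationary ergodic sequence of $\mathbb{R}^d$-valued random variables with common distribution $\mu$, with $\Vert X_k\Vert\le A$ almost surely for all $k$, satisfying the Devroye inequality with constants $D(\eta)$, $\eta\in(0,1]$. Let $\mathcal{E}_n=\frac1n\sum_{j=1}^n\delta_{X_j}$ be the empirical measure. Then for all $n\ge1$, $$\mathrm{var}\big(\kappa(\mathcal{E}_n,\mu)\big)\le\frac{D(1)}{n},$$ where $\kappa$ is the Kantorovich distance.
   Context: Kantorovich distance between probability measures on $\mathbb{R}^d$: $\kappa(\mu_1,\mu_2)=\sup_{g\in\mathscr{L}}\int g\,d(\mu_1-\mu_2)$, where $\mathscr{L}$ is the set of real-valued Lipschitz functions on $\mathbb{R}^d$ with Lipschitz constant at most one. $\delta_x$ is the Dirac measure at $x$, and $A>0$ is a constant. For $\eta\in(0,1]$, a function $K:(\mathbb{R}^d)^n\to\mathbb{R}$ is separately $\eta$-Hölder if for every $1\le j\le n$ $$L_j(K)=\sup_{x_1,\ldots,x_n}\ \sup_{\tilde x_j\ne x_j}\frac{|K(x_1,\ldots,x_j,\ldots,x_n)-K(x_1,\ldots,\tilde x_j,\ldots,x_n)|}{\Vert x_j-\tilde x_j\Vert^\eta}<\infty .$$ The process satisfies the Devroye inequality if for every $\eta\in(0,1]$ there is a constant $D=D(\eta)>0$ such that for every integer $n\ge1$ and every real-valued separately $\eta$-Hölder function $K$ on $(\mathbb{R}^d)^n$, $\mathrm{var}(K(X_1,\ldots,X_n))\le D\sum_{j=1}^n L_j(K)^2$.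 *)

theory Defs
  imports "HOL-Probability.Probability"
begin

text \<open>Sequences are indexed from 1, as functions on \<open>{1..}\<close>; a point of \<open>(\<real>\<^sup>d)\<^sup>n\<close> is an
  extensional function on \<open>{1..n}\<close>.\<close>

abbreviation seq_space :: "(nat \<Rightarrow> real ^ 'd) measure" where
  "seq_space \<equiv> PiM {1..} (\<lambda>_. borel)"

definition shift :: "(nat \<Rightarrow> real ^ 'd) \<Rightarrow> nat \<Rightarrow> real ^ 'd" where
  "shift x = (\<lambda>k\<in>{1..}. x (Suc k))"

definition process_law :: "'a measure \<Rightarrow> (nat \<Rightarrow> 'a \<Rightarrow> real ^ 'd) \<Rightarrow> (nat \<Rightarrow> real ^ 'd) measure" where
  "process_law M X = distr M seq_space (\<lambda>\<omega>. \<lambda>k\<in>{1..}. X k \<omega>)"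

definition stationary_process :: "'a measure \<Rightarrow> (nat \<Rightarrow> 'a \<Rightarrow> real ^ 'd) \<Rightarrow> bool" where
  "stationary_process M X \<longleftrightarrow> process_law M (\<lambda>k. X (Suc k)) = process_law M X"

definition ergodic_process :: "'a measure \<Rightarrow> (nat \<Rightarrow> 'a \<Rightarrow> real ^ 'd) \<Rightarrow> bool" where
  "ergodic_process M X \<longleftrightarrow>
     (\<forall>B\<in>sets seq_space. shift -` B \<inter> space seq_space = B \<longrightarrow>
        measure (process_law M X) B \<in> {0, 1})"

definition holder_quotients ::
    "real \<Rightarrow> nat \<Rightarrow> ((nat \<Rightarrow> real ^ 'd) \<Rightarrow> real) \<Rightarrow> nat \<Rightarrow> real set" where
  "holder_quotients \<eta> n K j =
     {\<bar>K x - K (x(j := y))\<bar> / norm (x j - y) powr \<eta> | x y. x \<in> {1..n} \<rightarrow>\<^sub>E UNIV \<and> y \<noteq> x j}"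

definition holder_const ::
    "real \<Rightarrow> nat \<Rightarrow> ((nat \<Rightarrow> real ^ 'd) \<Rightarrow> real) \<Rightarrow> nat \<Rightarrow> real" where
  "holder_const \<eta> n K j = Sup (holder_quotients \<eta> n K j)"

text \<open>Finiteness of the supremum is boundedness of the set of quotients, which is never empty
  for \<open>1 \<le> j \<le> n\<close>.\<close>

definition separately_holder :: "real \<Rightarrow> nat \<Rightarrow> ((nat \<Rightarrow> real ^ 'd) \<Rightarrow> real) \<Rightarrow> bool" where
  "separately_holder \<eta> n K \<longleftrightarrow> (\<forall>j\<in>{1..n}. bdd_above (holder_quotients \<eta> n K j))"

text \<open>A separately Hoelder function is continuous, so for an almost surely bounded process the
  variance below is that of an almost surely bounded random variable.\<close>

definition devroye_inequality ::
    "'a measure \<Rightarrow> (nat \<Rightarrow> 'a \<Rightarrow> real ^ 'd) \<Rightarrow> (real \<Rightarrow> real) \<Rightarrow> bool" where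
  "devroye_inequality M X D \<longleftrightarrow>
     (\<forall>\<eta>\<in>{0<..1}. D \<eta> > 0 \<and>
        (\<forall>n\<ge>1. \<forall>K. separately_holder \<eta> n K \<longrightarrow>
           prob_space.variance M (\<lambda>\<omega>. K (\<lambda>j\<in>{1..n}. X j \<omega>))
             \<le> D \<eta> * (\<Sum>j=1..n. (holder_const \<eta> n K j)\<^sup>2)))"

text \<open>The supremum is taken in the reals: this is the Kantorovich distance for probability
  measures with finite first moment, in particular for those carried by a bounded set.\<close>

definition kantorovich :: "(real ^ 'd) measure \<Rightarrow> (real ^ 'd) measure \<Rightarrow> real" where
  "kantorovich \<mu>\<^sub>1 \<mu>\<^sub>2 =
     (SUP g\<in>{g :: real ^ 'd \<Rightarrow> real. 1-lipschitz_on UNIV g}. (\<integral>x. g x \<partial>\<mu>\<^sub>1) - (\<integral>x. g x \<partial>\<mu>\<^sub>2))"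

definition empirical_measure :: "(nat \<Rightarrow> 'a \<Rightarrow> real ^ 'd) \<Rightarrow> nat \<Rightarrow> 'a \<Rightarrow> (real ^ 'd) measure" where
  "empirical_measure X n \<omega> =
     measure_of UNIV (sets borel) (\<lambda>B. (\<Sum>j=1..n. emeasure (return borel (X j \<omega>)) B) / of_nat n)"

text \<open>The set function above is a measure.\<close>

lemma sets_empirical_measure [simp]: "sets (empirical_measure X n \<omega>) = sets borel"
  unfolding empirical_measure_def by (metis sets.sets_measure_of_eq space_borel)

lemma emeasure_empirical_measure:
  fixes X :: "nat \<Rightarrow> 'a \<Rightarrow> real ^ 'd"
  assumes "B \<in> sets borel"
  shows "emeasure (empirical_measure X n \<omega>) B =
    (\<Sum>j=1..n. emeasure (return borel (X j \<omega>)) B) / of_nat n"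
proof (rule emeasure_measure_of[OF empirical_measure_def])
  show "sets borel \<subseteq> Pow (UNIV :: (real ^ 'd) set)" by simp
  show "B \<in> sets (empirical_measure X n \<omega>)" using assms by simp
  show "positive (sets (empirical_measure X n \<omega>))
      (\<lambda>B. (\<Sum>j=1..n. emeasure (return borel (X j \<omega>)) B) / of_nat n)"
    by (simp add: positive_def)
  show "countably_additive (sets (empirical_measure X n \<omega>))
      (\<lambda>B. (\<Sum>j=1..n. emeasure (return borel (X j \<omega>)) B) / of_nat n)"
  proof (rule countably_additiveI)
    fix F :: "nat \<Rightarrow> (real ^ 'd) set"
    assume F: "range F \<subseteq> sets (empirical_measure X n \<omega>)" "disjoint_family F"
    have *: "(\<Sum>i. emeasure (return borel x) (F i)) = emeasure (return borel x) (\<Union>(range F))"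
      for x :: "real ^ 'd"
      using F by (intro suminf_emeasure) auto
    show "(\<Sum>i. (\<Sum>j=1..n. emeasure (return borel (X j \<omega>)) (F i)) / of_nat n) =
        (\<Sum>j=1..n. emeasure (return borel (X j \<omega>)) (\<Union>(range F))) / of_nat n"
      by (simp only: ennreal_suminf_divide suminf_sum[OF summableI] *)
  qed
qed

end

theory Submission
  imports Defs
begin

text \<open>
  Integrating against the empirical measure turns \<open>\<kappa>(\<E>\<^sub>n, \<mu>)\<close> into
  \<open>K(X\<^sub>1, \<dots>, X\<^sub>n)\<close>, where \<open>K(x\<^sub>1, \<dots>, x\<^sub>n)\<close> is the supremum over the 1-Lipschitz functions \<open>g\<close> of
  \<open>1/n * (g(x\<^sub>1) + \<dots> + g(x\<^sub>n)) - \<integral>g d\<mu>\<close>. Replacing \<open>x\<^sub>j\<close> by \<open>y\<close> changes each of these expressions by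
  at most \<open>\<parallel>x\<^sub>j - y\<parallel>/n\<close>, hence also their supremum, so \<open>L\<^sub>j(K) \<le> 1/n\<close>, and the Devroye inequality
  with \<open>\<eta> = 1\<close> bounds the variance by \<open>D(1) * n * (1/n)\<^sup>2\<close>.
\<close>

text \<open>Both sides give \<open>B\<close> the proportion of indices \<open>j\<close> with
  \<open>X j \<omega> \<in> B\<close>, so repeated values count with multiplicity. As the image of a
  uniformly chosen index, the measure has integrals that are finite averages.\<close>

lemma empirical_measure_eq_distr_pmf_of_set:
  fixes X :: "nat \<Rightarrow> 'a \<Rightarrow> real ^ 'd"
  assumes "n \<ge> 1"
  shows "empirical_measure X n \<omega> = distr (measure_pmf (pmf_of_set {1..n})) borel (\<lambda>j. X j \<omega>)"
proof (rule measure_eqI)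
  fix B assume "B \<in> sets (empirical_measure X n \<omega>)"
  then have B: "B \<in> sets borel" by simp
  let ?J = "{j\<in>{1..n}. X j \<omega> \<in> B}"
  have "(\<Sum>j=1..n. emeasure (return borel (X j \<omega>)) B) = (\<Sum>j=1..n. if X j \<omega> \<in> B then 1 else 0)"
    using B by (intro sum.cong) (auto simp: indicator_def)
  also have "\<dots> = (\<Sum>j\<in>?J. 1 :: ennreal)"
    by (rule sum.inter_filter[symmetric]) simp
  also have "\<dots> = of_nat (card ?J)" by simp
  finally have "emeasure (empirical_measure X n \<omega>) B = of_nat (card ?J) / of_nat n"
    using emeasure_empirical_measure[OF B, of X n \<omega>] by simp
  moreover have "{1..n} \<inter> (\<lambda>j. X j \<omega>) -` B = ?J" by auto
  then have "emeasure (distr (measure_pmf (pmf_of_set {1..n})) borel (\<lambda>j. X j \<omega>)) B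
      = ennreal (real (card ?J) / real n)"
    using B assms by (simp add: emeasure_distr emeasure_pmf_of_set)
  moreover have "ennreal (real (card ?J) / real n) = of_nat (card ?J) / of_nat n"
    using assms by (simp add: divide_ennreal[symmetric] ennreal_of_nat_eq_real_of_nat)
  ultimately show "emeasure (empirical_measure X n \<omega>) B =
      emeasure (distr (measure_pmf (pmf_of_set {1..n})) borel (\<lambda>j. X j \<omega>)) B"
    by simp
qed simp

lemma integral_empirical_measure:
  fixes X :: "nat \<Rightarrow> 'a \<Rightarrow> real ^ 'd" and g :: "real ^ 'd \<Rightarrow> real"
  assumes "n \<ge> 1" "g \<in> borel_measurable borel"
  shows "(\<integral>x. g x \<partial>empirical_measure X n \<omega>) = (\<Sum>j=1..n. g (X j \<omega>)) / real n"
  using assms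
  by (simp add: empirical_measure_eq_distr_pmf_of_set integral_distr integral_pmf_of_set)

lemma abs_diff_le_of_lipschitz_1:
  fixes g :: "'a :: real_normed_vector \<Rightarrow> real"
  assumes "1-lipschitz_on UNIV g"
  shows "\<bar>g x - g y\<bar> \<le> norm (x - y)"
  using lipschitz_onD[OF assms, of x y] by (simp add: dist_norm)

lemma borel_measurable_lipschitz_on:
  fixes g :: "'a :: metric_space \<Rightarrow> 'b :: metric_space"
  assumes "C-lipschitz_on UNIV g"
  shows "g \<in> borel_measurable borel"
  using lipschitz_on_continuous_on[OF assms] by (rule borel_measurable_continuous_onI)

text \<open>Almost surely \<open>Y\<close> lies within \<open>norm x + A\<close> of
  \<open>x\<close>, so \<open>g (Y \<omega>)\<close> is that close to \<open>g x\<close>; then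
  average. The bound does not depend on \<open>g\<close>, which is what makes the Kantorovich
  supremum finite.\<close>

lemma (in prob_space) minus_expectation_lipschitz_le:
  fixes g :: "'b :: euclidean_space \<Rightarrow> real"
  assumes Y: "Y \<in> borel_measurable M" and bound: "AE \<omega> in M. norm (Y \<omega>) \<le> A"
    and g: "1-lipschitz_on UNIV g"
  shows "g x - expectation (\<lambda>\<omega>. g (Y \<omega>)) \<le> norm x + A"
proof -
  have meas: "(\<lambda>\<omega>. g (Y \<omega>)) \<in> borel_measurable M"
    using borel_measurable_lipschitz_on[OF g] Y by measurable
  have close: "AE \<omega> in M. \<bar>g x - g (Y \<omega>)\<bar> \<le> norm x + A"
    using bound
  proof eventually_elim
    case (elim \<omega>)
    show ?case
      using abs_diff_le_of_lipschitz_1[OF g, of x "Y \<omega>"] norm_triangle_ineq4[of x "Y \<omega>"] elim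
      by linarith
  qed
  \<comment> \<open>Integrability has to be secured before the integrals are compared, since a
    non-integrable function would get the default integral 0.\<close>
  have "AE \<omega> in M. norm (g (Y \<omega>)) \<le> \<bar>g x\<bar> + (norm x + A)"
    using close by eventually_elim auto
  then have int: "integrable M (\<lambda>\<omega>. g (Y \<omega>))"
    using meas by (rule integrable_const_bound)
  have "g x - (norm x + A) = expectation (\<lambda>\<omega>. g x - (norm x + A))"
    by (simp add: prob_space)
  also have "\<dots> \<le> expectation (\<lambda>\<omega>. g (Y \<omega>))"
    using close int by (intro integral_mono_AE) auto
  finally show ?thesis by simp
qed

text \<open>Each value of one family is at most \<open>c\<close> above the supremum of the other.
  Boundedness matters because \<open>Sup\<close> on the reals is an upper bound only for bounded
  sets.\<close>

lemma abs_cSUP_diff_le: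
  fixes f h :: "'a \<Rightarrow> real"
  assumes "I \<noteq> {}" "bdd_above (f ` I)" "bdd_above (h ` I)"
    and close: "\<And>i. i \<in> I \<Longrightarrow> \<bar>f i - h i\<bar> \<le> c"
  shows "\<bar>(SUP i\<in>I. f i) - (SUP i\<in>I. h i)\<bar> \<le> c"
proof -
  have "(SUP i\<in>I. f i) \<le> (SUP i\<in>I. h i) + c"
  proof (rule cSUP_least)
    fix i assume i: "i \<in> I"
    show "f i \<le> (SUP i\<in>I. h i) + c"
      using close[OF i] cSUP_upper[OF i assms(3)] by linarith
  qed fact
  moreover have "(SUP i\<in>I. h i) \<le> (SUP i\<in>I. f i) + c"
  proof (rule cSUP_least)
    fix i assume i: "i \<in> I"
    show "h i \<le> (SUP i\<in>I. f i) + c"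
      using close[OF i] cSUP_upper[OF i assms(2)] by linarith
  qed fact
  ultimately show ?thesis by linarith
qed

lemma holder_quotient_1_bound:
  fixes K :: "(nat \<Rightarrow> real ^ 'd) \<Rightarrow> real"
  assumes lip: "\<And>x y. \<bar>K x - K (x(j := y))\<bar> \<le> c * norm (x j - y)"
    and q: "q \<in> holder_quotients 1 n K j"
  shows "0 \<le> q" "q \<le> c"
proof -
  obtain x y where xy: "q = \<bar>K x - K (x(j := y))\<bar> / norm (x j - y) powr 1" "y \<noteq> x j"
    using q unfolding holder_quotients_def by blast
  then have "norm (x j - y) > 0" by simp
  with xy(1) lip[of x y] show "0 \<le> q" "q \<le> c"
    by (auto simp: pos_divide_le_eq)
qed

text \<open>The dimension is at least 1, so a nonzero vector exists and the zero point can be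
  changed in coordinate \<open>j\<close>. Bounds on the real \<open>Sup\<close> of the quotients
  rest on this.\<close>

lemma holder_quotients_nonempty:
  fixes K :: "(nat \<Rightarrow> real ^ 'd) \<Rightarrow> real"
  assumes "j \<in> {1..n}"
  shows "holder_quotients \<eta> n K j \<noteq> {}"
proof -
  obtain y :: "real ^ 'd" where "y \<noteq> 0"
    using nonzero_Basis nonempty_Basis by blast
  then have "y \<noteq> (\<lambda>i\<in>{1..n}. 0) j" using assms by simp
  moreover have "(\<lambda>i\<in>{1..n}. 0 :: real ^ 'd) \<in> {1..n} \<rightarrow>\<^sub>E UNIV" by simp
  ultimately show ?thesis
    unfolding holder_quotients_def by blast
qed

text \<open>The lower bound 0 is there so that the upper bound can later be squared.\<close>

lemma holder_const_1_bound:
  fixes K :: "(nat \<Rightarrow> real ^ 'd) \<Rightarrow> real"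
  assumes lip: "\<And>x y. \<bar>K x - K (x(j := y))\<bar> \<le> c * norm (x j - y)"
    and j: "j \<in> {1..n}"
  shows "bdd_above (holder_quotients 1 n K j)"
    and "0 \<le> holder_const 1 n K j" "holder_const 1 n K j \<le> c"
proof -
  show bdd: "bdd_above (holder_quotients 1 n K j)"
    using holder_quotient_1_bound(2)[OF lip] by (rule bdd_aboveI)
  show "holder_const 1 n K j \<le> c"
    unfolding holder_const_def
    using holder_quotients_nonempty[OF j] holder_quotient_1_bound(2)[OF lip] by (rule cSup_least)
  obtain q where "q \<in> holder_quotients 1 n K j"
    using holder_quotients_nonempty[OF j, of 1 K] by blast
  then show "0 \<le> holder_const 1 n K j"
    unfolding holder_const_def
    using holder_quotient_1_bound(1)[OF lip] cSup_upper[OF _ bdd] by fastforce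
qed

theorem theorem5p1:
  fixes M :: "'a measure" and X :: "nat \<Rightarrow> 'a \<Rightarrow> real ^ 'd"
    and \<mu> :: "(real ^ 'd) measure" and A :: real and D :: "real \<Rightarrow> real"
  assumes "prob_space M"
    and "\<And>k. k \<ge> 1 \<Longrightarrow> X k \<in> borel_measurable M"
    and "stationary_process M X"
    and "ergodic_process M X"
    and "\<And>k. k \<ge> 1 \<Longrightarrow> distr M borel (X k) = \<mu>"
    and "A > 0"
    and "\<And>k. k \<ge> 1 \<Longrightarrow> (AE \<omega> in M. norm (X k \<omega>) \<le> A)"
    and "devroye_inequality M X D"
  shows "\<forall>n\<ge>1. prob_space.variance M (\<lambda>\<omega>. kantorovich (empirical_measure X n \<omega>) \<mu>) \<le> D 1 / real n"
proof (intro allI impI)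
  fix n :: nat assume n: "n \<ge> 1"
  interpret prob_space M by fact
  define lip where "lip = {g :: real ^ 'd \<Rightarrow> real. 1-lipschitz_on UNIV g}"
  define F where "F x g = (\<Sum>j=1..n. g (x j)) / real n - (\<integral>y. g y \<partial>\<mu>)"
    for x and g :: "real ^ 'd \<Rightarrow> real"
  define K where "K x = (SUP g\<in>lip. F x g)" for x
  have lip_ne: "lip \<noteq> {}"
    unfolding lip_def using lipschitz_on_le[OF lipschitz_on_constant[of UNIV "0 :: real"], of 1] by auto
  have bdd: "bdd_above (F x ` lip)" for x
  proof (rule bdd_aboveI2)
    fix g assume "g \<in> lip"
    then have g: "1-lipschitz_on UNIV g" by (simp add: lip_def)
    \<comment> \<open>\<open>X 1\<close> serves as a bounded random variable with law
      \<open>\<mu>\<close>.\<close>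
    have \<mu>: "(\<integral>y. g y \<partial>\<mu>) = expectation (\<lambda>\<omega>. g (X 1 \<omega>))"
      using assms(2,5)[of 1] borel_measurable_lipschitz_on[OF g] by (auto simp: integral_distr)
    have "F x g = (\<Sum>j=1..n. g (x j) - (\<integral>y. g y \<partial>\<mu>)) / real n"
      using n by (simp add: F_def sum_subtractf diff_divide_distrib)
    also have "\<dots> \<le> (\<Sum>j=1..n. norm (x j) + A) / real n"
      unfolding \<mu> using assms(2,7)[of 1] g
      by (intro divide_right_mono sum_mono minus_expectation_lipschitz_le) auto
    finally show "F x g \<le> (\<Sum>j=1..n. norm (x j) + A) / real n" .
  qed
  have K_lip: "\<bar>K x - K (x(j := y))\<bar> \<le> 1 / real n * norm (x j - y)" if j: "j \<in> {1..n}" for x y j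
    unfolding K_def
  proof (rule abs_cSUP_diff_le[OF lip_ne bdd bdd])
    fix g assume "g \<in> lip"
    then have g: "1-lipschitz_on UNIV g" by (simp add: lip_def)
    \<comment> \<open>Splitting off the summand \<open>j\<close> leaves a common rest; this rest and
      the integral against \<open>\<mu>\<close> cancel in the difference.\<close>
    have "(\<Sum>i=1..n. g ((x(j := y)) i)) = g y + (\<Sum>i\<in>{1..n} - {j}. g (x i))"
      using j by (subst sum.remove[of _ j]) (auto intro!: sum.cong)
    moreover have "(\<Sum>i=1..n. g (x i)) = g (x j) + (\<Sum>i\<in>{1..n} - {j}. g (x i))"
      using j by (subst sum.remove[of _ j]) auto
    ultimately have "F x g - F (x(j := y)) g = (g (x j) - g y) / real n"
      by (simp add: F_def diff_divide_distrib add_divide_distrib)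
    then show "\<bar>F x g - F (x(j := y)) g\<bar> \<le> 1 / real n * norm (x j - y)"
      using abs_diff_le_of_lipschitz_1[OF g, of "x j" y] by (simp add: abs_divide divide_right_mono)
  qed
  \<comment> \<open>The identity holds for every \<open>\<omega>\<close>, so it can be rewritten
    inside the variance. Restricting to \<open>{1..n}\<close> is harmless because \<open>F\<close>
    reads only these coordinates.\<close>
  have kant: "kantorovich (empirical_measure X n \<omega>) \<mu> = K (\<lambda>j\<in>{1..n}. X j \<omega>)" for \<omega>
    unfolding kantorovich_def K_def lip_def F_def
    by (intro SUP_cong) (auto simp: integral_empirical_measure[OF n] borel_measurable_lipschitz_on)
  note K_bound = holder_const_1_bound[of K _ "1 / real n" n, OF K_lip]
  have "separately_holder 1 n K"
    unfolding separately_holder_def by (intro ballI K_bound(1))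
  then have "variance (\<lambda>\<omega>. K (\<lambda>j\<in>{1..n}. X j \<omega>)) \<le> D 1 * (\<Sum>j=1..n. (holder_const 1 n K j)\<^sup>2)"
    and "D 1 > 0"
    using assms(8) n unfolding devroye_inequality_def by auto
  moreover have "(\<Sum>j=1..n. (holder_const 1 n K j)\<^sup>2) \<le> (\<Sum>j=1..n. (1 / real n)\<^sup>2)"
    by (intro sum_mono power_mono K_bound(2,3))
  moreover have "(\<Sum>j=1..n. (1 / real n)\<^sup>2) = 1 / real n"
    using n by (simp add: power2_eq_square)
  ultimately show "variance (\<lambda>\<omega>. kantorovich (empirical_measure X n \<omega>) \<mu>) \<le> D 1 / real n"
    unfolding kant using mult_left_mono[of _ "1 / real n" "D 1"] by fastforce
qed

end
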